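(* Let $v$ be an $\alpha$-flow on the compact metric space $(X,d)$, where $\alpha$ is a nontrivial continuous 1-cocycle. Let $\{s_i\}$ be a sequence of positive numbers with $s_i\to0$ as $i\to\infty$. (a) If for any $M>0$ and $T>0$ there is, for each $s_i$, a $(\mathcal U(s_i),T)$-chain $\tilde\gamma_i$ such that $\left|\int_{\tilde\gamma_i}\alpha\right|\ge M$, then $v$ is not a gradient-like flow. (b) If for any $M>0$ there is a trajectory $\tilde\gamma$ of $v$ with $\left|\int_{\tilde\gamma}\alpha\right|\ge M$, then $v$ is not a gradient-like flow. (c) If there is an oriented cycle $\tilde\gamma_0$ consisting of some orbits of $v$ joining fixed points, with direction determined by the forward direction of the flow, such that $\left|\int_{\tilde\gamma_0}\alpha\right|\ge1$, then $v$ is not a gradient-like flow.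
   Context: A flow $v$ is a continuous $\mathbb R$-action $(x,t)\mapsto x\cdot t$ on $X$; its fixed point set $S_v$ is assumed to have finitely many connected components. $[x,x\cdot t]$ denotes a trajectory segment. The flow is gradient-like if there is a continuous function $g:X\to\mathbb R$ (a Lyapunov function) which is strictly decreasing along every nonconstant trajectory. Cocycles. A continuous 1-cocycle (in bounded Alexander–Spanier cohomology) is a bounded function $\alpha:X\times X\to\mathbb R$ for which there is $r>0$ such that for each open ball $B$ of radius $r$ there is a bounded continuous function $\beta_B$ on $\bar B$ with $\alpha(x,y)=\beta_B(y)-\beta_B(x)$ for $x,y\in\bar B$. It is trivial (a coboundary) if there is a continuous $g:X\to\mathbb R$ with $\alpha(x,y)=g(y)-g(x)$ for all $(x,y)$ in a neighborhood of the diagonal, and nontrivial otherwise; $[\alpha]$ is its cohomology class. For a curve $\gamma:[a,b]\to X$, $\int_\gamma\alpha=\sum_i\alpha(\gamma(\tau_i),\gamma(\tau_{i+1}))$ for any sufficiently fine subdivision of $[a,b]$. Chains. $\mathcal U(s)$ denotes a covering of $X$ by balls of radius $s$. A $(\mathcal U(s),T)$-chain from $x$ to $x'$ is a sequence $\{x=x_1,\dots,x_{k+1}=x'\mid t_1,\dots,t_k\}$ with $t_i\ge T$ such that each pair $(x_i\cdot t_i,x_{i+1})$ lies in a common ball of $\mathcal U(s)$. For such a chain, $\int_{\tilde\gamma}\alpha=\sum_i\big(\int_{[x_i,x_i\cdot t_i]}\alpha+\alpha(x_i\cdot t_i,x_{i+1})\big)$. $\alpha$-flow. Let $\mathcal A$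 be an isolated invariant set of $v$ containing $S_v$, with finitely many connected components $A_1,\dots,A_n$. For $A_i$ with isolating neighborhood $U_i$, closed neighborhood $V_i\subset U_i$ of $A_i$ and small $r>0$, the flow neighborhood $A_i(r)=A_i(V_i,r)$ is the compact set of points $x\in V_i$ whose forward or backward orbit reaches the closed $r$-neighborhood of $A_i$ without leaving $V_i$. The maximal trajectory pieces of $v$ in $X\setminus\bigcup_iA_i(r)$ are divided into $\Gamma_1^{\mathcal A}(r)$ (time domain $(a,b)$ bounded), $\Gamma_2^{\mathcal A}(r)$ (time domain $(a,+\infty)$ or $(-\infty,b)$), and $\Gamma_3^{\mathcal A}(r)$ (time domain $\mathbb R$). If $[\alpha]$ restricts to $0$ on an open set, so $\alpha=\delta\beta$ there, i.e. $\alpha(x,y)=\beta(y)-\beta(x)$ locally with $\beta$ continuous, put $I_\alpha(x,y)=\beta(y)-\beta(x)$. The flow $v$ is a generalized $\alpha$-flow with respect to $\mathcal A$ if there are a small $r>0$, $T_0>0$, $\rho>0$ and $0\le\lambda<1$ such that: (1) $[\alpha]|_{A_i}=0$ and $\max_{(x,y)\in A_i(r)\times A_i(r)}|I_\alpha(x,y)|\le\lambda\rho$ for $1\le i\le n$; (2) $\int_\gamma\alpha\ge\rho$ for every $\gamma\in\Gamma^{\mathcal A}_1(r)$; (3) $\int_{\gamma(T_0)}\alpha\ge\rho$ for every sub-trajectory $\gamma(T_0)$ of time length $T_0$ of any $\gamma\in\Gamma_2^{\mathcal A}(r)\cup\Gamma_3^{\mathcal A}(r)$. It is an $\alpha$-flow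 if moreover $\mathcal A$ consists only of points. *)

theory Defs
  imports "HOL-Analysis.Analysis"
begin

section \<open>Flows\<close>

definition is_flow :: "('a::metric_space \<Rightarrow> real \<Rightarrow> 'a) \<Rightarrow> bool" where
  "is_flow v \<longleftrightarrow>
     continuous_on UNIV (\<lambda>(x, t). v x t) \<and>
     (\<forall>x. v x 0 = x) \<and> (\<forall>x s t. v (v x s) t = v x (s + t))"

definition fixed_points :: "('a \<Rightarrow> real \<Rightarrow> 'a) \<Rightarrow> 'a set" where
  "fixed_points v = {x. \<forall>t. v x t = x}"

definition gradient_like :: "('a::metric_space \<Rightarrow> real \<Rightarrow> 'a) \<Rightarrow> bool" where
  "gradient_like v \<longleftrightarrow>
     (\<exists>g :: 'a \<Rightarrow> real. continuous_on UNIV g \<and>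
        (\<forall>x. x \<notin> fixed_points v \<longrightarrow> (\<forall>s t. s < t \<longrightarrow> g (v x t) < g (v x s))))"

definition maximal_invariant :: "('a \<Rightarrow> real \<Rightarrow> 'a) \<Rightarrow> 'a set \<Rightarrow> 'a set" where
  "maximal_invariant v N = {x. \<forall>t. v x t \<in> N}"

definition isolating_neighborhood ::
    "('a::metric_space \<Rightarrow> real \<Rightarrow> 'a) \<Rightarrow> 'a set \<Rightarrow> 'a set \<Rightarrow> bool" where
  "isolating_neighborhood v A N \<longleftrightarrow>
     compact N \<and> A \<subseteq> interior N \<and> maximal_invariant v N = A"

definition isolated_invariant_set ::
    "('a::metric_space \<Rightarrow> real \<Rightarrow> 'a) \<Rightarrow> 'a set \<Rightarrow> bool" where
  "isolated_invariant_set v A \<longleftrightarrow> (\<exists>N. isolating_neighborhood v A N)"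


section \<open>Cocycles and their integrals\<close>

definition continuous_cocycle :: "('a::metric_space \<Rightarrow> 'a \<Rightarrow> real) \<Rightarrow> bool" where
  "continuous_cocycle \<alpha> \<longleftrightarrow>
     bounded (range (\<lambda>(x, y). \<alpha> x y)) \<and>
     (\<exists>r>0. \<forall>z. \<exists>\<beta>. continuous_on (closure (ball z r)) \<beta> \<and>
        bounded (\<beta> ` closure (ball z r)) \<and>
        (\<forall>x\<in>closure (ball z r). \<forall>y\<in>closure (ball z r). \<alpha> x y = \<beta> y - \<beta> x))"

text \<open>On \<open>S\<close>, the cocycle \<open>\<alpha>\<close> is the coboundary of \<open>\<beta>\<close>; as always in Alexander-Spanier
  cohomology, the identity is only required near the diagonal.\<close>

definition primitive_on ::
    "('a::metric_space \<Rightarrow> 'a \<Rightarrow> real) \<Rightarrow> 'a set \<Rightarrow> ('a \<Rightarrow> real) \<Rightarrow> bool" where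
  "primitive_on \<alpha> S \<beta> \<longleftrightarrow>
     continuous_on S \<beta> \<and>
     (\<exists>D. open D \<and> (\<forall>x\<in>S. (x, x) \<in> D) \<and>
        (\<forall>x\<in>S. \<forall>y\<in>S. (x, y) \<in> D \<longrightarrow> \<alpha> x y = \<beta> y - \<beta> x))"

definition trivial_on :: "('a::metric_space \<Rightarrow> 'a \<Rightarrow> real) \<Rightarrow> 'a set \<Rightarrow> bool" where
  "trivial_on \<alpha> S \<longleftrightarrow> (\<exists>\<beta>. primitive_on \<alpha> S \<beta>)"

definition nontrivial :: "('a::metric_space \<Rightarrow> 'a \<Rightarrow> real) \<Rightarrow> bool" where
  "nontrivial \<alpha> \<longleftrightarrow> \<not> trivial_on \<alpha> UNIV"

definition subdivision :: "real \<Rightarrow> real \<Rightarrow> real \<Rightarrow> nat \<Rightarrow> (nat \<Rightarrow> real) \<Rightarrow> bool" where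
  "subdivision a b \<delta> n \<tau> \<longleftrightarrow>
     \<tau> 0 = a \<and> \<tau> n = b \<and> (\<forall>i<n. \<tau> i < \<tau> (Suc i) \<and> \<tau> (Suc i) - \<tau> i < \<delta>)"

text \<open>For a cocycle and a curve that is continuous on \<open>[a, b]\<close>, \<open>a \<le> b\<close>, the sums are eventually
  constant as the mesh shrinks, so the value below is then well defined.\<close>

definition cocycle_integral ::
    "('a \<Rightarrow> 'a \<Rightarrow> real) \<Rightarrow> (real \<Rightarrow> 'a) \<Rightarrow> real \<Rightarrow> real \<Rightarrow> real" where
  "cocycle_integral \<alpha> \<gamma> a b =
     (THE I. \<exists>\<delta>>0. \<forall>n \<tau>. subdivision a b \<delta> n \<tau> \<longrightarrow>
        (\<Sum>i<n. \<alpha> (\<gamma> (\<tau> i)) (\<gamma> (\<tau> (Suc i)))) = I)"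


section \<open>Chains\<close>

definition ball_cover :: "real \<Rightarrow> 'a::metric_space set set \<Rightarrow> bool" where
  "ball_cover s \<C> \<longleftrightarrow> (\<forall>B\<in>\<C>. \<exists>z. B = ball z s) \<and> \<Union>\<C> = UNIV"

text \<open>The chain \<open>{x 1, \<dots>, x (k + 1) | t 1, \<dots>, t k}\<close>.\<close>

definition is_chain ::
    "('a \<Rightarrow> real \<Rightarrow> 'a) \<Rightarrow> 'a set set \<Rightarrow> real \<Rightarrow> nat \<Rightarrow> (nat \<Rightarrow> 'a) \<Rightarrow> (nat \<Rightarrow> real) \<Rightarrow> bool" where
  "is_chain v \<C> T k x t \<longleftrightarrow>
     k \<ge> 1 \<and>
     (\<forall>i\<in>{1..k}. t i \<ge> T \<and> (\<exists>B\<in>\<C>. v (x i) (t i) \<in> B \<and> x (Suc i) \<in> B))"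

definition chain_integral ::
    "('a \<Rightarrow> real \<Rightarrow> 'a) \<Rightarrow> ('a \<Rightarrow> 'a \<Rightarrow> real) \<Rightarrow> nat \<Rightarrow> (nat \<Rightarrow> 'a) \<Rightarrow> (nat \<Rightarrow> real) \<Rightarrow> real" where
  "chain_integral v \<alpha> k x t =
     (\<Sum>i=1..k. cocycle_integral \<alpha> (v (x i)) 0 (t i) + \<alpha> (v (x i) (t i)) (x (Suc i)))"


section \<open>Generalized alpha-flows\<close>

text \<open>The sign of \<open>t\<close> distinguishes forward from backward orbits.\<close>

definition flow_neighborhood ::
    "('a::metric_space \<Rightarrow> real \<Rightarrow> 'a) \<Rightarrow> 'a set \<Rightarrow> 'a set \<Rightarrow> real \<Rightarrow> 'a set" where
  "flow_neighborhood v A V r =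
     {x\<in>V. \<exists>t. infdist (v x t) A \<le> r \<and> (\<forall>\<tau>\<in>closed_segment 0 t. v x \<tau> \<in> V)}"

text \<open>A trajectory piece is a pair \<open>(x, J)\<close>, standing for the curve \<open>t \<mapsto> v x t\<close> with time
  domain \<open>J\<close>.  It is maximal outside \<open>K\<close> when \<open>J\<close> is a component of the set of times spent
  outside \<open>K\<close>.\<close>

definition maximal_pieces ::
    "('a \<Rightarrow> real \<Rightarrow> 'a) \<Rightarrow> 'a set \<Rightarrow> ('a \<times> real set) set" where
  "maximal_pieces v K = {(x, J). J \<in> components {t. v x t \<notin> K}}"

definition Gamma1 :: "('a \<Rightarrow> real \<Rightarrow> 'a) \<Rightarrow> 'a set \<Rightarrow> ('a \<times> real set) set" where
  "Gamma1 v K = {(x, J) \<in> maximal_pieces v K. \<exists>a b. a < b \<and> J = {a<..<b}}"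

definition Gamma2 :: "('a \<Rightarrow> real \<Rightarrow> 'a) \<Rightarrow> 'a set \<Rightarrow> ('a \<times> real set) set" where
  "Gamma2 v K = {(x, J) \<in> maximal_pieces v K. \<exists>a. J = {a<..} \<or> J = {..<a}}"

definition Gamma3 :: "('a \<Rightarrow> real \<Rightarrow> 'a) \<Rightarrow> 'a set \<Rightarrow> ('a \<times> real set) set" where
  "Gamma3 v K = {(x, J) \<in> maximal_pieces v K. J = UNIV}"

text \<open>The isolating neighborhoods \<open>U C\<close> and closed neighborhoods \<open>V C\<close> are indexed by the
  components \<open>C\<close> of \<open>A\<close>.  Smallness of \<open>r\<close> means that the closed \<open>r\<close>-neighborhood of each
  component \<open>C\<close> lies in \<open>V C\<close>.  In the bound by \<open>\<mu> * \<rho>\<close>, \<open>\<beta> y - \<beta> x\<close> is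
  \<open>I\<^sub>\<alpha>(x, y)\<close>; \<open>\<mu>\<close> is the constant usually called lambda.\<close>

definition generalized_alpha_flow ::
    "('a::metric_space \<Rightarrow> real \<Rightarrow> 'a) \<Rightarrow> ('a \<Rightarrow> 'a \<Rightarrow> real) \<Rightarrow> 'a set \<Rightarrow> bool" where
  "generalized_alpha_flow v \<alpha> A \<longleftrightarrow>
     isolated_invariant_set v A \<and> fixed_points v \<subseteq> A \<and> finite (components A) \<and>
     (\<exists>U V r T\<^sub>0 \<rho> \<mu>.
        (\<forall>C\<in>components A. isolating_neighborhood v C (U C) \<and>
           closed (V C) \<and> C \<subseteq> interior (V C) \<and> V C \<subseteq> U C \<and> {x. infdist x C \<le> r} \<subseteq> V C) \<and>
        r > 0 \<and> T\<^sub>0 > 0 \<and> \<rho> > 0 \<and> 0 \<le> \<mu> \<and> \<mu> < 1 \<and>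
        (\<forall>C\<in>components A. trivial_on \<alpha> C \<and>
           (\<exists>W \<beta>. open W \<and> flow_neighborhood v C (V C) r \<subseteq> W \<and> primitive_on \<alpha> W \<beta> \<and>
              (\<forall>x\<in>flow_neighborhood v C (V C) r. \<forall>y\<in>flow_neighborhood v C (V C) r.
                 \<bar>\<beta> y - \<beta> x\<bar> \<le> \<mu> * \<rho>))) \<and>
        (let K = (\<Union>C\<in>components A. flow_neighborhood v C (V C) r) in
           (\<forall>x a b. a < b \<and> (x, {a<..<b}) \<in> Gamma1 v K \<longrightarrow>
              cocycle_integral \<alpha> (v x) a b \<ge> \<rho>) \<and>
           (\<forall>(x, J)\<in>Gamma2 v K \<union> Gamma3 v K. \<forall>c. {c..c + T\<^sub>0} \<subseteq> J \<longrightarrow>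
              cocycle_integral \<alpha> (v x) c (c + T\<^sub>0) \<ge> \<rho>)))"

definition alpha_flow ::
    "('a::metric_space \<Rightarrow> real \<Rightarrow> 'a) \<Rightarrow> ('a \<Rightarrow> 'a \<Rightarrow> real) \<Rightarrow> bool" where
  "alpha_flow v \<alpha> \<longleftrightarrow>
     (\<exists>A. generalized_alpha_flow v \<alpha> A \<and> (\<forall>C\<in>components A. \<exists>p. C = {p}))"


section \<open>Oriented cycles of orbits\<close>

text \<open>A closed curve on \<open>[0, 1]\<close> that runs through finitely many whole nonconstant orbits, each
  reparametrized from \<open>(-\<infinity>, \<infinity>)\<close> to an interval by an increasing bijection \<open>h\<close> (hence a
  homeomorphism) and traversed in the forward direction; the division points are mapped to
  fixed points.\<close>

definition oriented_orbit_cycle ::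
    "('a::metric_space \<Rightarrow> real \<Rightarrow> 'a) \<Rightarrow> (real \<Rightarrow> 'a) \<Rightarrow> bool" where
  "oriented_orbit_cycle v \<gamma> \<longleftrightarrow>
     path \<gamma> \<and> pathfinish \<gamma> = pathstart \<gamma> \<and>
     (\<exists>k \<tau>. \<tau> 0 = 0 \<and> \<tau> k = 1 \<and>
        (\<forall>i\<le>k. \<gamma> (\<tau> i) \<in> fixed_points v) \<and>
        (\<forall>i<k. \<tau> i < \<tau> (Suc i) \<and>
           (\<exists>x h. x \<notin> fixed_points v \<and>
              strict_mono_on {\<tau> i<..<\<tau> (Suc i)} h \<and>
              h ` {\<tau> i<..<\<tau> (Suc i)} = (UNIV :: real set) \<and>
              (\<forall>s\<in>{\<tau> i<..<\<tau> (Suc i)}. \<gamma> s = v x (h s)))))"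

end

theory Submission
  imports Defs
begin

text \<open>Suppose that the flow has a Lyapunov function \<open>g\<close>.  The components of the isolated
  invariant set of an \<open>\<alpha>\<close>-flow are finitely many points, and this set contains the fixed
  points; hence there are only finitely many fixed points.

  Near its finitely many fixed points the cocycle is a coboundary: there is a continuous
  \<open>\<phi>\<close> on the whole space with \<open>\<alpha> = \<delta>\<phi>\<close> near each of them
  (\<open>cocycle_primitive_near_finite_set\<close>).  Passing from \<open>\<alpha>\<close> to
  \<open>\<alpha>' = \<alpha> - \<delta>\<phi>\<close> changes the integral over any chain by at most
  \<open>2 sup \<bar>\<phi>\<bar>\<close>, so it suffices to bound integrals of \<open>\<alpha>'\<close>.  Cut an orbit
  segment into steps of length comparable to a small \<open>\<sigma>\<close>.  A step that starts near a fixed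
  point contributes nothing, and every other step lowers \<open>g\<close> by at least a fixed
  \<open>\<epsilon> > 0\<close>, by compactness.  Hence the integral of \<open>\<alpha>'\<close> over a segment of
  length at least \<open>\<sigma>\<close> is at most a constant times the drop of \<open>g\<close>, and it vanishes if that drop is less than \<open>\<epsilon>\<close>
  (\<open>orbit_integral_estimate\<close>).  As \<open>g\<close> is bounded, this settles (b).

  For (a), the jumps of a chain may raise \<open>g\<close>, and the sum of all drops along a chain need not
  be bounded: a chain can stay near a fixed point for ever, repeatedly jumping up and flowing down.
  But only the segments with a drop of at least \<open>\<epsilon>\<close> matter, since any other segment ends near
  a fixed point, where a small jump does not contribute either.  Choose finitely many levels that
  avoid the critical values, which are the values of \<open>g\<close> at fixed points, and are so dense that
  every drop of size \<open>\<epsilon>\<close> meets one of them.  The flow pushes each such level down by a definite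
  amount, which beats all sufficiently small jumps; so a chain crosses each level at most twice
  (\<open>card_level_crossings\<close>), and the number of relevant segments is bounded independently of the
  length of the chain.

  For (c), \<open>g\<close> strictly decreases along each orbit of an oriented cycle and is continuous at the
  fixed points between them, so the cycle could not close up.\<close>

section \<open>Integrals of cocycles along curves\<close>

text \<open>The intended \<open>F\<close> is a cocycle pulled back to the time axis along an orbit, which is additive
  at short range only.  A primitive is continued from \<open>[0, n\<sigma>]\<close> to \<open>[0, (n + 1)\<sigma>]\<close> by anchoring
  it at \<open>n\<sigma>\<close>.\<close>

lemma additive_function_primitive:
  fixes F :: "real \<Rightarrow> real \<Rightarrow> real"
  assumes "\<sigma> > 0"
    and add: "\<And>a b c. \<bar>a - b\<bar> \<le> \<sigma> \<Longrightarrow> \<bar>b - c\<bar> \<le> \<sigma> \<Longrightarrow> \<bar>a - c\<bar> \<le> \<sigma> \<Longrightarrow> F a b + F b c = F a c"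
  shows "\<exists>\<Phi>. \<forall>a\<in>{0..t}. \<forall>b\<in>{0..t}. \<bar>a - b\<bar> \<le> \<sigma> \<longrightarrow> F a b = \<Phi> b - \<Phi> a"
proof -
  have ex: "\<exists>\<Phi>. \<forall>a\<in>{0..real n * \<sigma>}. \<forall>b\<in>{0..real n * \<sigma>}. \<bar>a - b\<bar> \<le> \<sigma> \<longrightarrow> F a b = \<Phi> b - \<Phi> a" for n
  proof (induction n)
    case 0
    have "F 0 0 = 0" using add[of 0 0 0] assms(1) by simp
    then show ?case by auto
  next
    case (Suc n)
    then obtain \<Phi> where \<Phi>: "\<And>a b. \<lbrakk>0 \<le> a; a \<le> real n * \<sigma>; 0 \<le> b; b \<le> real n * \<sigma>; \<bar>a - b\<bar> \<le> \<sigma>\<rbrakk>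
        \<Longrightarrow> F a b = \<Phi> b - \<Phi> a" by auto
    define q where "q = real n * \<sigma>"
    have q0: "0 \<le> q" using assms(1) by (simp add: q_def)
    have Sq: "real (Suc n) * \<sigma> = q + \<sigma>" by (simp add: q_def algebra_simps)
    have refl: "F q q = 0" using add[of q q q] assms(1) by simp
    define \<Psi> where "\<Psi> a = (if a \<le> q then \<Phi> a else \<Phi> q + F q a)" for a
    have "F a b = \<Psi> b - \<Psi> a" if ab: "0 \<le> a" "a \<le> q + \<sigma>" "0 \<le> b" "b \<le> q + \<sigma>" "\<bar>a - b\<bar> \<le> \<sigma>" for a b
    proof (cases "a \<le> q"; cases "b \<le> q")
      assume "a \<le> q" "b \<le> q"
      then show ?thesis using \<Phi>[of a b] ab by (simp add: \<Psi>_def q_def)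
    next
      assume c: "a \<le> q" "\<not> b \<le> q"
      then have "F a q = \<Phi> q - \<Phi> a" using \<Phi>[of a q] ab q0 by (simp add: q_def)
      moreover have "F a q + F q b = F a b" using c ab by (intro add) auto
      ultimately show ?thesis using c by (simp add: \<Psi>_def)
    next
      assume c: "\<not> a \<le> q" "b \<le> q"
      then have "F q b = \<Phi> b - \<Phi> q" using \<Phi>[of q b] ab q0 by (simp add: q_def)
      moreover have "F q a + F a b = F q b" using c ab by (intro add) auto
      ultimately show ?thesis using c by (simp add: \<Psi>_def)
    next
      assume c: "\<not> a \<le> q" "\<not> b \<le> q"
      have "F q a + F a b = F q b" using c ab by (intro add) auto
      then show ?thesis using c by (simp add: \<Psi>_def)
    qed
    then show ?case unfolding Sq by (intro exI[of _ \<Psi>]) auto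
  qed
  obtain n :: nat where n: "t / \<sigma> \<le> real n" using real_arch_simple by blast
  then have "t \<le> real n * \<sigma>" using assms(1) by (simp add: field_simps)
  then show ?thesis using ex[of n] by (meson atLeastAtMost_iff order_trans)
qed

lemma subdivision_exists:
  assumes "a \<le> b" "\<delta> > 0"
  shows "\<exists>n \<tau>. subdivision a b \<delta> n \<tau>"
proof (cases "a = b")
  case True
  then have "subdivision a b \<delta> 0 (\<lambda>_. a)" by (simp add: subdivision_def)
  then show ?thesis by blast
next
  case False
  obtain n :: nat where n: "(b - a) / \<delta> < real n" using reals_Archimedean2 by blast
  moreover have "0 < (b - a) / \<delta>" using False assms by simp
  ultimately have n0: "real n > 0" by linarith
  define h where "h = (b - a) / real n"
  have "h > 0" "h < \<delta>" "real n * h = b - a" using n n0 False assms by (auto simp: h_def field_simps)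
  then have "subdivision a b \<delta> n (\<lambda>i. a + real i * h)"
    unfolding subdivision_def by (auto simp: algebra_simps)
  then show ?thesis by blast
qed

text \<open>Sums over subdivisions of mesh less than \<open>\<sigma>\<close> telescope to the difference of the values of
  the primitive.  For the uniqueness of the integral, arbitrarily fine subdivisions have to exist.\<close>

lemma cocycle_integral_eq_primitive_diff:
  assumes "\<sigma> > 0" "a \<le> b"
    and prim: "\<And>s t. \<lbrakk>s \<in> {a..b}; t \<in> {a..b}; \<bar>s - t\<bar> \<le> \<sigma>\<rbrakk> \<Longrightarrow> \<alpha> (\<gamma> s) (\<gamma> t) = \<Phi> t - \<Phi> s"
  shows "cocycle_integral \<alpha> \<gamma> a b = \<Phi> b - \<Phi> a"
proof -
  have sum: "(\<Sum>i<n. \<alpha> (\<gamma> (\<tau> i)) (\<gamma> (\<tau> (Suc i)))) = \<Phi> b - \<Phi> a"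
    if s: "subdivision a b \<sigma> n \<tau>" for n \<tau>
  proof -
    have mono: "\<tau> i \<le> \<tau> j" if "i \<le> j" "j \<le> n" for i j
      using that
    proof (induction j rule: dec_induct)
      case (step m)
      then have "\<tau> m < \<tau> (Suc m)" using s by (simp add: subdivision_def)
      with step show ?case by simp
    qed simp
    have in_ab: "\<tau> i \<in> {a..b}" if "i \<le> n" for i
      using mono[of 0 i] mono[of i n] that s by (simp add: subdivision_def)
    have "(\<Sum>i<n. \<alpha> (\<gamma> (\<tau> i)) (\<gamma> (\<tau> (Suc i)))) = (\<Sum>i<n. \<Phi> (\<tau> (Suc i)) - \<Phi> (\<tau> i))"
    proof (rule sum.cong[OF refl])
      fix i assume "i \<in> {..<n}"
      then have "\<tau> i \<in> {a..b}" "\<tau> (Suc i) \<in> {a..b}" "\<tau> i < \<tau> (Suc i)" "\<tau> (Suc i) - \<tau> i < \<sigma>"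
        using in_ab s by (auto simp: subdivision_def)
      then show "\<alpha> (\<gamma> (\<tau> i)) (\<gamma> (\<tau> (Suc i))) = \<Phi> (\<tau> (Suc i)) - \<Phi> (\<tau> i)"
        by (intro prim) auto
    qed
    also have "\<dots> = \<Phi> (\<tau> n) - \<Phi> (\<tau> 0)" by (rule sum_lessThan_telescope)
    finally show ?thesis using s by (simp add: subdivision_def)
  qed
  show ?thesis unfolding cocycle_integral_def
  proof (rule the_equality)
    show "\<exists>\<delta>>0. \<forall>n \<tau>. subdivision a b \<delta> n \<tau> \<longrightarrow>
        (\<Sum>i<n. \<alpha> (\<gamma> (\<tau> i)) (\<gamma> (\<tau> (Suc i)))) = \<Phi> b - \<Phi> a"
      using sum assms(1) by blast
  next
    fix I
    assume "\<exists>\<delta>>0. \<forall>n \<tau>. subdivision a b \<delta> n \<tau> \<longrightarrow>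
        (\<Sum>i<n. \<alpha> (\<gamma> (\<tau> i)) (\<gamma> (\<tau> (Suc i)))) = I"
    then obtain \<delta> where \<delta>: "\<delta> > 0" "\<And>n \<tau>. subdivision a b \<delta> n \<tau> \<Longrightarrow>
        (\<Sum>i<n. \<alpha> (\<gamma> (\<tau> i)) (\<gamma> (\<tau> (Suc i)))) = I" by blast
    obtain n \<tau> where "subdivision a b (min \<delta> \<sigma>) n \<tau>"
      using subdivision_exists[of a b "min \<delta> \<sigma>"] assms \<delta> by auto
    then have "subdivision a b \<delta> n \<tau>" "subdivision a b \<sigma> n \<tau>"
      by (auto simp: subdivision_def)
    then show "I = \<Phi> b - \<Phi> a" using \<delta>(2) sum by metis
  qed
qed

text \<open>Induction over the points: near a new point \<open>p\<close>, a local primitive \<open>\<beta>\<close> is glued to the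
  primitive \<open>\<phi>\<close> that serves the earlier points, by adding to \<open>\<phi>\<close> the difference
  \<open>\<beta> - \<phi>\<close> times a cutoff function.\<close>

lemma cocycle_primitive_near_finite_set:
  fixes \<alpha> :: "'a::metric_space \<Rightarrow> 'a \<Rightarrow> real"
  assumes "continuous_cocycle \<alpha>" "finite S"
  shows "\<exists>\<phi> \<delta>. continuous_on UNIV \<phi> \<and> \<delta> > 0 \<and>
    (\<forall>p\<in>S. \<forall>x\<in>ball p \<delta>. \<forall>y\<in>ball p \<delta>. \<alpha> x y = \<phi> y - \<phi> x)"
  using assms(2)
proof (induction S)
  case empty
  show ?case by (intro exI[of _ "\<lambda>_. 0"] exI[of _ 1]) auto
next
  case (insert p S)
  from insert.IH obtain \<phi> \<delta> where \<phi>: "continuous_on UNIV \<phi>" "\<delta> > 0"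
    "\<And>q x y. \<lbrakk>q \<in> S; x \<in> ball q \<delta>; y \<in> ball q \<delta>\<rbrakk> \<Longrightarrow> \<alpha> x y = \<phi> y - \<phi> x"
    by blast
  from assms(1) obtain r where r: "r > 0" and
    "\<And>z. \<exists>\<beta>. continuous_on (closure (ball z r)) \<beta> \<and>
        (\<forall>x\<in>closure (ball z r). \<forall>y\<in>closure (ball z r). \<alpha> x y = \<beta> y - \<beta> x)"
    unfolding continuous_cocycle_def by meson
  then obtain \<beta> where "continuous_on (closure (ball p r)) \<beta>" and
    "\<forall>x\<in>closure (ball p r). \<forall>y\<in>closure (ball p r). \<alpha> x y = \<beta> y - \<beta> x"
    by blast
  then have \<beta>: "continuous_on (ball p r) \<beta>"
    "\<And>x y. x \<in> ball p r \<Longrightarrow> y \<in> ball p r \<Longrightarrow> \<alpha> x y = \<beta> y - \<beta> x"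
    using closure_subset[of "ball p r"] by (blast intro: continuous_on_subset)+
  obtain d where d: "d > 0" "\<And>q. q \<in> S \<Longrightarrow> q \<noteq> p \<Longrightarrow> d \<le> dist p q"
    using finite_set_avoid[OF insert.hyps(1), of p] by metis
  \<comment> \<open>The cutoff is \<open>1\<close> on the ball of radius \<open>e\<close> about \<open>p\<close> and \<open>0\<close> outside the ball of
    radius \<open>2e\<close>, which misses the \<open>e\<close>-balls about the earlier points.\<close>
  define e where "e = min r d / 3"
  have e: "e > 0" "2 * e < r" "3 * e \<le> d" using r d by (auto simp: e_def min_def)
  define \<psi> where "\<psi> x = (if dist p x \<le> 2 * e then min 1 (2 - dist p x / e) * (\<beta> x - \<phi> x) else 0)" for x
  have "continuous_on (cball p (2 * e) \<union> {x. 2 * e \<le> dist p x}) \<psi>"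
    unfolding \<psi>_def
  proof (rule continuous_on_cases)
    show "closed {x. 2 * e \<le> dist p x}" by (intro closed_Collect_le continuous_intros)
    have "continuous_on (cball p (2 * e)) \<beta>" "continuous_on (cball p (2 * e)) \<phi>"
      using \<beta>(1) \<phi>(1) e by (auto elim!: continuous_on_subset)
    then show "continuous_on (cball p (2 * e)) (\<lambda>x. min 1 (2 - dist p x / e) * (\<beta> x - \<phi> x))"
      using e by (intro continuous_intros) auto
  next
    have "2 - dist p x / e = 0" if "2 * e = dist p x" for x using e unfolding that[symmetric] by simp
    then show "\<forall>x. x \<in> cball p (2 * e) \<and> \<not> dist p x \<le> 2 * e \<or>
        x \<in> {x. 2 * e \<le> dist p x} \<and> dist p x \<le> 2 * e \<longrightarrow>
        min 1 (2 - dist p x / e) * (\<beta> x - \<phi> x) = 0"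
      by (metis (no_types, lifting) mem_Collect_eq mem_cball min_def mult_zero_left not_one_le_zero order.antisym)
  qed (use e in auto)
  moreover have "cball p (2 * e) \<union> {x. 2 * e \<le> dist p x} = UNIV" by auto
  ultimately have "continuous_on UNIV \<psi>" by simp
  then have cont: "continuous_on UNIV (\<lambda>x. \<phi> x + \<psi> x)" using \<phi>(1) by (intro continuous_intros)
  have near_p: "\<phi> x + \<psi> x = \<beta> x" if "dist p x < e" for x
  proof -
    have "dist p x / e < 1" using that e by simp
    then show ?thesis using that e by (simp add: \<psi>_def)
  qed
  have far: "\<psi> x = 0" if "2 * e \<le> dist p x" for x
  proof (cases "dist p x = 2 * e")
    case True
    then have "dist p x / e = 2" using e by simp
    then show ?thesis by (simp add: \<psi>_def)
  next
    case False
    then show ?thesis using that by (simp add: \<psi>_def)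
  qed
  have "\<alpha> x y = (\<phi> y + \<psi> y) - (\<phi> x + \<psi> x)"
    if q: "q \<in> insert p S" and x: "x \<in> ball q (min \<delta> e)" and y: "y \<in> ball q (min \<delta> e)" for q x y
  proof (cases "q = p")
    case True
    then show ?thesis using \<beta>(2)[of x y] near_p[of x] near_p[of y] x y e by simp
  next
    case False
    then have "q \<in> S" "3 * e \<le> dist p q" using q d(2)[of q] e by auto
    moreover have "2 * e \<le> dist p x" "2 * e \<le> dist p y"
      using \<open>3 * e \<le> dist p q\<close> x y dist_triangle[of p q x] dist_triangle[of p q y]
      by (auto simp: dist_commute)
    ultimately show ?thesis using \<phi>(3)[of q x y] far x y by simp
  qed
  then show ?case using cont \<phi>(2) e(1)
    by (intro exI[of _ "\<lambda>x. \<phi> x + \<psi> x"] exI[of _ "min \<delta> e"]) auto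
qed

section \<open>Flows with a Lyapunov function\<close>

lemma flow_short_time_displacement:
  fixes v :: "'a::metric_space \<Rightarrow> real \<Rightarrow> 'a"
  assumes "compact (UNIV :: 'a set)" "is_flow v" "e > 0"
  shows "\<exists>\<sigma>>0. \<forall>x t. \<bar>t\<bar> \<le> \<sigma> \<longrightarrow> dist (v x t) x < e"
proof -
  have "continuous_on (UNIV \<times> {-1..1}) (\<lambda>(x, t). v x t)"
    using assms(2) unfolding is_flow_def by (auto elim: continuous_on_subset)
  then have "uniformly_continuous_on (UNIV \<times> {-1..1}) (\<lambda>(x, t). v x t)"
    using assms(1) by (intro compact_uniformly_continuous compact_Times) auto
  then obtain d where d: "d > 0" and
    "\<forall>p\<in>UNIV \<times> {-1..1}. \<forall>q\<in>UNIV \<times> {-1..1}. dist q p < d \<longrightarrow>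
       dist ((\<lambda>(x, t). v x t) q) ((\<lambda>(x, t). v x t) p) < e"
    using assms(3) unfolding uniformly_continuous_on_def by blast
  then have close: "dist (v x t) (v x 0) < e" if "\<bar>t\<bar> \<le> 1" "\<bar>t\<bar> < d" for x t
    using that by (force simp: dist_Pair_Pair dist_real_def)
  show ?thesis
  proof (intro exI conjI allI impI)
    show "min 1 (d / 2) > 0" using d by simp
    fix x t assume "\<bar>t\<bar> \<le> min 1 (d / 2)"
    then show "dist (v x t) x < e" using close[of t x] d assms(2) by (simp add: is_flow_def)
  qed
qed

locale lyapunov_flow =
  fixes v :: "'a::metric_space \<Rightarrow> real \<Rightarrow> 'a" and g :: "'a \<Rightarrow> real"
  assumes compact_space: "compact (UNIV :: 'a set)"
    and flow: "is_flow v"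
    and finite_fixed: "finite (fixed_points v)"
    and continuous_g: "continuous_on UNIV g"
    and g_strict: "\<And>x s t. x \<notin> fixed_points v \<Longrightarrow> s < t \<Longrightarrow> g (v x t) < g (v x s)"
begin

lemma flow_0 [simp]: "v x 0 = x"
  and flow_add: "v (v x s) t = v x (s + t)"
  using flow by (auto simp: is_flow_def)

lemma g_mono: "s \<le> t \<Longrightarrow> g (v x t) \<le> g (v x s)"
  using g_strict[of x s t] by (cases "x \<in> fixed_points v"; cases "s = t") (auto simp: fixed_points_def)

lemma continuous_time_map: "continuous_on S (\<lambda>x. v x t)"
proof -
  have "continuous_on S ((\<lambda>(x, t). v x t) \<circ> (\<lambda>x. (x, t)))"
    using flow unfolding is_flow_def
    by (intro continuous_on_compose continuous_intros) (auto elim: continuous_on_subset)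
  then show ?thesis by (simp add: o_def)
qed

lemma continuous_g_time: "continuous_on S (\<lambda>x. g (v x t))"
  by (rule continuous_on_compose2[OF continuous_g continuous_time_map]) simp

lemma g_bounded: "\<exists>m M. \<forall>x. m \<le> g x \<and> g x \<le> M"
  using continuous_attains_inf[OF compact_space _ continuous_g]
    continuous_attains_sup[OF compact_space _ continuous_g] by (metis UNIV_I UNIV_not_empty)

text \<open>Away from the fixed points, the drops of \<open>g\<close> in the next and in the previous \<open>\<sigma>\<close> units
  of time are positive and continuous, hence bounded below by compactness.  The backward estimate
  controls the point at which an orbit segment ends.\<close>

lemma uniform_g_drop:
  assumes "closed S" "S \<inter> fixed_points v = {}" "\<sigma> > 0"
  shows "\<exists>\<epsilon>>0. \<forall>x\<in>S. g x - g (v x \<sigma>) \<ge> \<epsilon> \<and> g (v x (-\<sigma>)) - g x \<ge> \<epsilon>"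
proof (cases "S = {}")
  case True
  then show ?thesis by (intro exI[of _ 1]) auto
next
  case False
  define q where "q x = min (g x - g (v x \<sigma>)) (g (v x (-\<sigma>)) - g x)" for x
  have "compact S" using compact_Int_closed[OF compact_space assms(1)] by simp
  moreover have "continuous_on S q" unfolding q_def
    by (intro continuous_intros continuous_g_time continuous_on_subset[OF continuous_g]) auto
  ultimately obtain x0 where x0: "x0 \<in> S" "\<And>x. x \<in> S \<Longrightarrow> q x0 \<le> q x"
    using continuous_attains_inf[of S q] False by blast
  have "q x0 > 0"
    using g_strict[of x0 0 \<sigma>] g_strict[of x0 "-\<sigma>" 0] assms(2,3) x0(1) by (auto simp: q_def)
  then show ?thesis using x0(2) by (intro exI[of _ "q x0"]) (force simp: q_def)
qed

text \<open>A point that is at most at a regular level \<open>a\<close> falls strictly below it: either it moves, or it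
  is a fixed point and its level is not \<open>a\<close>.  So the continuous function
  \<open>max (g x - a) (a - g (v x \<sigma>))\<close> is positive everywhere, and half its minimum can serve as
  \<open>\<omega>\<close>.\<close>

lemma regular_level_gap:
  assumes "a \<notin> g ` fixed_points v" "\<sigma> > 0"
  shows "\<exists>\<omega>>0. \<forall>x t. t \<ge> \<sigma> \<longrightarrow> g x \<le> a + \<omega> \<longrightarrow> g (v x t) \<le> a - \<omega>"
proof -
  define q where "q x = max (g x - a) (a - g (v x \<sigma>))" for x
  have "continuous_on UNIV q" unfolding q_def
    by (intro continuous_intros continuous_g_time continuous_g)
  then obtain x0 where x0: "\<And>x. q x0 \<le> q x"
    using continuous_attains_inf[OF compact_space, of q] by auto
  have "q x0 > 0"
  proof (cases "x0 \<in> fixed_points v")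
    case True
    then have "g x0 \<noteq> a" "v x0 \<sigma> = x0" using assms(1) by (auto simp: fixed_points_def)
    then show ?thesis by (auto simp: q_def)
  next
    case False
    then show ?thesis using g_strict[of x0 0 \<sigma>] assms(2) by (auto simp: q_def)
  qed
  moreover have "g (v x t) \<le> a - q x0 / 2" if "t \<ge> \<sigma>" "g x \<le> a + q x0 / 2" for x t
  proof -
    have "q x0 \<le> max (g x - a) (a - g (v x \<sigma>))" using x0[of x] by (simp add: q_def)
    then have "a - g (v x \<sigma>) \<ge> q x0" using that \<open>q x0 > 0\<close> by linarith
    then show ?thesis using g_mono[OF that(1), of x] \<open>q x0 > 0\<close> by linarith
  qed
  ultimately show ?thesis by (intro exI[of _ "q x0 / 2"]) auto
qed

lemma uniform_regular_level_gap:
  assumes "finite P" "P \<inter> g ` fixed_points v = {}" "\<sigma> > 0"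
  shows "\<exists>\<omega>>0. \<forall>a\<in>P. \<forall>x t. t \<ge> \<sigma> \<longrightarrow> g x \<le> a + \<omega> \<longrightarrow> g (v x t) \<le> a - \<omega>"
  using assms(1,2)
proof (induction P)
  case empty
  show ?case by (intro exI[of _ 1]) auto
next
  case (insert a P)
  then obtain \<omega> where \<omega>: "\<omega> > 0"
    "\<And>b x t. b \<in> P \<Longrightarrow> t \<ge> \<sigma> \<Longrightarrow> g x \<le> b + \<omega> \<Longrightarrow> g (v x t) \<le> b - \<omega>" by auto
  obtain \<omega>' where \<omega>': "\<omega>' > 0" "\<And>x t. t \<ge> \<sigma> \<Longrightarrow> g x \<le> a + \<omega>' \<Longrightarrow> g (v x t) \<le> a - \<omega>'"
    using regular_level_gap[of a \<sigma>] insert.prems assms(3) by auto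
  have "g (v x t) \<le> b - min \<omega> \<omega>'"
    if "b \<in> insert a P" "t \<ge> \<sigma>" "g x \<le> b + min \<omega> \<omega>'" for b x t
    using that \<omega>(2)[of b t x] \<omega>'(2)[of t x] by force
  then show ?case using \<omega>(1) \<omega>'(1) by (intro exI[of _ "min \<omega> \<omega>'"]) auto
qed

text \<open>Strict decrease on the open interval passes to the end points only as a weak inequality by
  continuity; two interior points \<open>c < d\<close> keep it strict.\<close>

lemma cycle_piece_decreases_g:
  fixes a b :: real
  assumes "continuous_on {a..b} \<gamma>" "a < b" "x \<notin> fixed_points v"
    and h: "strict_mono_on {a<..<b} h"
    and \<gamma>: "\<And>s. s \<in> {a<..<b} \<Longrightarrow> \<gamma> s = v x (h s)"
  shows "g (\<gamma> b) < g (\<gamma> a)"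
proof -
  have cont: "continuous_on {a..b} (\<lambda>s. g (\<gamma> s))"
    by (rule continuous_on_compose2[OF continuous_g assms(1)]) simp
  have dec: "g (\<gamma> t) < g (\<gamma> s)" if "a < s" "s < t" "t < b" for s t
  proof -
    have st: "s \<in> {a<..<b}" "t \<in> {a<..<b}" using that by auto
    then have "h s < h t" using strict_mono_onD[OF h] that(2) by blast
    then show ?thesis using g_strict[OF assms(3)] \<gamma>[OF st(1)] \<gamma>[OF st(2)] by simp
  qed
  define c d where "c = a + (b - a) / 3" and "d = a + 2 * (b - a) / 3"
  have cd: "a < c" "c < d" "d < b" using assms(2) by (auto simp: c_def d_def field_simps)
  have "g (\<gamma> a) \<ge> g (\<gamma> c)"
  proof (rule continuous_ge_on_closure[of "{a<..<c}" "\<lambda>s. g (\<gamma> s)"])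
    show "continuous_on (closure {a<..<c}) (\<lambda>s. g (\<gamma> s))"
      using cont cd by (auto elim: continuous_on_subset)
    show "a \<in> closure {a<..<c}" using cd by simp
    show "\<And>s. s \<in> {a<..<c} \<Longrightarrow> g (\<gamma> c) \<le> g (\<gamma> s)" using dec[of _ c] cd by force
  qed
  moreover have "g (\<gamma> b) \<le> g (\<gamma> d)"
  proof (rule continuous_le_on_closure[of "{d<..<b}" "\<lambda>s. g (\<gamma> s)"])
    show "continuous_on (closure {d<..<b}) (\<lambda>s. g (\<gamma> s))"
      using cont cd by (auto elim: continuous_on_subset)
    show "b \<in> closure {d<..<b}" using cd by simp
    show "\<And>s. s \<in> {d<..<b} \<Longrightarrow> g (\<gamma> s) \<le> g (\<gamma> d)" using dec[of d] cd by force
  qed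
  ultimately show ?thesis using dec[of c d] cd by linarith
qed

lemma no_oriented_orbit_cycle: "\<not> oriented_orbit_cycle v \<gamma>"
proof
  assume "oriented_orbit_cycle v \<gamma>"
  then obtain k \<tau> where path: "path \<gamma>" "pathfinish \<gamma> = pathstart \<gamma>"
    and \<tau>: "\<tau> 0 = 0" "\<tau> k = (1 :: real)"
    and steps: "\<forall>i<k. \<tau> i < \<tau> (Suc i) \<and>
           (\<exists>x h. x \<notin> fixed_points v \<and>
              strict_mono_on {\<tau> i<..<\<tau> (Suc i)} h \<and>
              h ` {\<tau> i<..<\<tau> (Suc i)} = (UNIV :: real set) \<and>
              (\<forall>s\<in>{\<tau> i<..<\<tau> (Suc i)}. \<gamma> s = v x (h s)))"
    unfolding oriented_orbit_cycle_def by (elim conjE exE)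
  have inc: "\<tau> i < \<tau> (Suc i)" if "i < k" for i
    using steps that by simp
  have mono: "\<tau> i \<le> \<tau> j" if "i \<le> j" "j \<le> k" for i j
    using that
  proof (induction j rule: dec_induct)
    case (step m)
    then show ?case using inc[of m] by simp
  qed simp
  have drop: "g (\<gamma> (\<tau> (Suc i))) < g (\<gamma> (\<tau> i))" if "i < k" for i
  proof -
    obtain x h where xh: "x \<notin> fixed_points v" "strict_mono_on {\<tau> i<..<\<tau> (Suc i)} h"
      "\<And>s. s \<in> {\<tau> i<..<\<tau> (Suc i)} \<Longrightarrow> \<gamma> s = v x (h s)" 
      using steps[rule_format, OF \<open>i < k\<close>] by meson
    have "continuous_on {\<tau> i..\<tau> (Suc i)} \<gamma>"
      using path(1) mono[of 0 i] mono[of "Suc i" k] that \<tau>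
      unfolding path_def by (auto elim!: continuous_on_subset)
    then show ?thesis using cycle_piece_decreases_g[OF _ inc[OF that] xh] by blast
  qed
  have less: "g (\<gamma> (\<tau> j)) < g (\<gamma> (\<tau> 0))" if "0 < j" "j \<le> k" for j
    using that
  proof (induction j)
    case (Suc j)
    then show ?case using drop[of j] by (cases "j = 0") auto
  qed simp
  have "k > 0" using \<tau> by (cases k) auto
  then show False using less[of k] path(2) \<tau> by (simp add: pathfinish_def pathstart_def)
qed

text \<open>The corrected cocycle \<open>\<alpha>' x y = \<alpha> x y - (\<phi> y - \<phi> x)\<close> vanishes near the fixed points, and its
  integral over an orbit segment is controlled by the drop of \<open>g\<close>: a step outside the
  neighbourhood \<open>N\<close> of the fixed points costs at least \<open>\<epsilon>\<close>.  If the whole segment drops by less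
  than \<open>\<epsilon>\<close>, then all its steps start in \<open>N\<close>, and so it ends in \<open>N\<close> as well; thus neither the
  segment nor a small jump from its end contributes to the integral of \<open>\<alpha>'\<close>.\<close>

lemma orbit_integral_estimate:
  assumes "continuous_cocycle \<alpha>"
  shows "\<exists>\<phi> B \<epsilon> \<sigma> \<delta>. \<epsilon> > 0 \<and> \<sigma> > 0 \<and> \<delta> > 0 \<and>
    (\<forall>x. \<bar>\<phi> x\<bar> \<le> B) \<and> (\<forall>x y. \<bar>\<alpha> x y - (\<phi> y - \<phi> x)\<bar> \<le> B) \<and>
    (\<forall>x t. 0 \<le> t \<longrightarrow> \<bar>cocycle_integral \<alpha> (v x) 0 t - (\<phi> (v x t) - \<phi> x)\<bar> \<le> B) \<and>
    (\<forall>x t. \<sigma> \<le> t \<longrightarrow> g x - g (v x t) < \<epsilon> \<longrightarrow>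
       cocycle_integral \<alpha> (v x) 0 t = \<phi> (v x t) - \<phi> x \<and>
       (\<forall>y. dist (v x t) y < \<delta> \<longrightarrow> \<alpha> (v x t) y = \<phi> y - \<phi> (v x t)))"
proof -
  obtain \<phi> \<delta> where \<phi>: "continuous_on UNIV \<phi>" "\<delta> > 0"
    "\<And>p x y. \<lbrakk>p \<in> fixed_points v; x \<in> ball p \<delta>; y \<in> ball p \<delta>\<rbrakk> \<Longrightarrow> \<alpha> x y = \<phi> y - \<phi> x"
    using cocycle_primitive_near_finite_set[OF assms finite_fixed] by blast
  from assms obtain b r where b: "\<And>x y. \<bar>\<alpha> x y\<bar> \<le> b" and r: "r > 0" and
    local: "\<And>z. \<exists>\<beta>. \<forall>x\<in>closure (ball z r). \<forall>y\<in>closure (ball z r). \<alpha> x y = \<beta> y - \<beta> x"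
    unfolding continuous_cocycle_def bounded_iff by (fastforce simp: real_norm_def)
  have add: "\<alpha> x y + \<alpha> y z = \<alpha> x z" if "dist y x < r" "dist y z < r" for x y z
  proof -
    obtain \<beta> where "\<forall>x\<in>closure (ball y r). \<forall>z\<in>closure (ball y r). \<alpha> x z = \<beta> z - \<beta> x"
      using local by blast
    moreover have "x \<in> closure (ball y r)" "y \<in> closure (ball y r)" "z \<in> closure (ball y r)"
      using that r closure_subset[of "ball y r"] by auto
    ultimately show ?thesis by simp
  qed
  have "compact (range \<phi>)" using compact_continuous_image[OF \<phi>(1) compact_space] .
  then obtain c where c: "\<And>x. \<bar>\<phi> x\<bar> \<le> c"
    using compact_imp_bounded[of "range \<phi>"] by (auto simp: bounded_iff)
  define B where "B = b + 2 * c"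
  define \<alpha>' where "\<alpha>' x y = \<alpha> x y - (\<phi> y - \<phi> x)" for x y
  have \<alpha>'_B: "\<bar>\<alpha>' x y\<bar> \<le> B" for x y
    using b[of x y] c[of x] c[of y] unfolding \<alpha>'_def B_def by linarith
  obtain \<sigma> where \<sigma>: "\<sigma> > 0" "\<And>x t. \<bar>t\<bar> \<le> \<sigma> \<Longrightarrow> dist (v x t) x < min r (\<delta> / 2)"
    using flow_short_time_displacement[OF compact_space flow, of "min r (\<delta> / 2)"] r \<phi>(2) by auto
  have close: "dist (v x s) (v x t) < min r (\<delta> / 2)" if "\<bar>s - t\<bar> \<le> \<sigma>" for x s t
    using \<sigma>(2)[of "s - t" "v x t"] that by (simp add: flow_add)
  \<comment> \<open>Half of the radius \<open>\<delta>\<close> leaves room for one step or one jump that starts in \<open>N\<close>.\<close>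
  define N where "N = (\<Union>p\<in>fixed_points v. ball p (\<delta> / 2))"
  have N0: "\<alpha>' x y = 0" if "x \<in> N" "dist x y < \<delta> / 2" for x y
  proof -
    from that(1) obtain p where p: "p \<in> fixed_points v" "x \<in> ball p (\<delta> / 2)"
      unfolding N_def by (rule UN_E)
    have "dist p x < \<delta> / 2" using p(2) by simp
    then have "dist p y < \<delta>" using dist_triangle[of p y x] that(2) by linarith
    then show ?thesis using \<phi>(3)[OF p(1), of x y] p(2) \<phi>(2) by (simp add: \<alpha>'_def)
  qed
  have "closed (- N)" unfolding N_def by (intro closed_Compl open_UN) auto
  moreover have "- N \<inter> fixed_points v = {}" using \<phi>(2) unfolding N_def by force
  ultimately obtain \<epsilon> where \<epsilon>: "\<epsilon> > 0"
    and drop: "\<And>x. x \<notin> N \<Longrightarrow> g x - g (v x (\<sigma> / 2)) \<ge> \<epsilon>" "\<And>x. x \<notin> N \<Longrightarrow> g (v x (- (\<sigma> / 2))) - g x \<ge> \<epsilon>"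
    using uniform_g_drop[of "- N" "\<sigma> / 2"] \<sigma>(1) by auto
  obtain m M where mM: "\<And>x. m \<le> g x" "\<And>x. g x \<le> M" using g_bounded by blast
  have B0: "B \<ge> 0" using \<alpha>'_B[of undefined undefined] by linarith
  define J where "J x t = cocycle_integral \<alpha> (v x) 0 t - (\<phi> (v x t) - \<phi> x)" for x t
  have J_telescope: "J x (real n * h) = (\<Sum>j<n. \<alpha>' (v x (real j * h)) (v x (real (Suc j) * h)))"
    if h: "0 \<le> h" "h \<le> \<sigma>" for x n h
  proof -
    obtain \<Phi> where \<Phi>: "\<And>a b. \<lbrakk>a \<in> {0..real n * h}; b \<in> {0..real n * h}; \<bar>a - b\<bar> \<le> \<sigma>\<rbrakk>
        \<Longrightarrow> \<alpha> (v x a) (v x b) = \<Phi> b - \<Phi> a"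
      using additive_function_primitive[of \<sigma> "\<lambda>a b. \<alpha> (v x a) (v x b)" "real n * h"] \<sigma>(1) add close
      by (metis (no_types, lifting) dist_commute min_less_iff_conj)
    have I: "cocycle_integral \<alpha> (v x) 0 (real n * h) = \<Phi> (real n * h) - \<Phi> 0"
      using cocycle_integral_eq_primitive_diff[of \<sigma> 0 "real n * h" \<alpha> "v x" \<Phi>] \<Phi> \<sigma>(1) h by simp
    define \<Psi> where "\<Psi> j = \<Phi> (real j * h) - \<phi> (v x (real j * h))" for j :: nat
    have "(\<Sum>j<n. \<alpha>' (v x (real j * h)) (v x (real (Suc j) * h))) = (\<Sum>j<n. \<Psi> (Suc j) - \<Psi> j)"
    proof (rule sum.cong[OF refl])
      fix j assume "j \<in> {..<n}"
      then have "real j * h \<in> {0..real n * h}" "real (Suc j) * h \<in> {0..real n * h}"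
        using h by (auto intro!: mult_right_mono simp del: of_nat_Suc)
      moreover have "\<bar>real j * h - real (Suc j) * h\<bar> \<le> \<sigma>" using h by (simp add: algebra_simps)
      ultimately show "\<alpha>' (v x (real j * h)) (v x (real (Suc j) * h)) = \<Psi> (Suc j) - \<Psi> j"
        using \<Phi> unfolding \<alpha>'_def \<Psi>_def by simp
    qed
    also have "\<dots> = \<Psi> n - \<Psi> 0" by (rule sum_lessThan_telescope)
    finally show ?thesis using I by (simp add: J_def \<Psi>_def)
  qed
  \<comment> \<open>Equal steps avoid a short last one, whose drop of \<open>g\<close> would have no lower bound.\<close>
  have steps: "\<exists>n h. t = real n * h \<and> \<sigma> / 2 \<le> h \<and> h \<le> \<sigma>" if "\<sigma> \<le> t" for t
  proof -
    define n where "n = nat \<lceil>t / \<sigma>\<rceil>"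
    have q: "t / \<sigma> \<ge> 1" using that \<sigma>(1) by simp
    then have n: "t / \<sigma> \<le> real n" "real n < t / \<sigma> + 1" unfolding n_def by linarith+
    then have "real n \<ge> 1" "real n \<le> 2 * (t / \<sigma>)" using q by linarith+
    then show ?thesis using n(1) \<sigma>(1)
      by (intro exI[of _ n] exI[of _ "t / real n"]) (auto simp: field_simps)
  qed
  have step_bound: "\<bar>\<alpha>' x (v x h)\<bar> \<le> B / \<epsilon> * (g x - g (v x h))" if h: "\<sigma> / 2 \<le> h" "h \<le> \<sigma>" for x h
  proof (cases "x \<in> N")
    case True
    have "dist x (v x h) < \<delta> / 2" using close[of 0 h x] h \<sigma>(1) by simp
    then show ?thesis using N0[OF True] g_mono[of 0 h x] h \<sigma>(1) B0 \<epsilon> by simp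
  next
    case False
    then have "g x - g (v x h) \<ge> \<epsilon>" using drop(1) g_mono[OF h(1), of x] by force
    then have "B / \<epsilon> * \<epsilon> \<le> B / \<epsilon> * (g x - g (v x h))" using B0 \<epsilon> by (intro mult_left_mono) auto
    then show ?thesis using \<alpha>'_B[of x "v x h"] \<epsilon> by simp
  qed
  have v_Suc: "v x (real (Suc j) * h) = v (v x (real j * h)) h" for x j h
    by (simp add: flow_add algebra_simps)
  have J_long: "\<bar>J x t\<bar> \<le> B / \<epsilon> * (M - m)" if t: "\<sigma> \<le> t" for x t
  proof -
    obtain n h where nh: "t = real n * h" "\<sigma> / 2 \<le> h" "h \<le> \<sigma>" using steps[OF t] by blast
    have "\<bar>J x t\<bar> \<le> (\<Sum>j<n. \<bar>\<alpha>' (v x (real j * h)) (v x (real (Suc j) * h))\<bar>)"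
      using J_telescope[of h x n] nh \<sigma>(1) by (simp add: sum_abs)
    also have "\<dots> \<le> (\<Sum>j<n. B / \<epsilon> * (g (v x (real j * h)) - g (v x (real (Suc j) * h))))"
      using step_bound nh unfolding v_Suc by (intro sum_mono) blast
    also have "\<dots> = B / \<epsilon> * (g x - g (v x t))"
      unfolding sum_distrib_left[symmetric]
      using sum_lessThan_telescope'[of "\<lambda>j. g (v x (real j * h))" n] nh(1) by simp
    also have "\<dots> \<le> B / \<epsilon> * (M - m)"
      using mM(1)[of "v x t"] mM(2)[of x] B0 \<epsilon> by (intro mult_left_mono) auto
    finally show ?thesis .
  qed
  have J_short: "\<bar>J x t\<bar> \<le> B" if "0 \<le> t" "t \<le> \<sigma>" for x t
    using J_telescope[of t x 1] \<alpha>'_B[of x "v x t"] that by simp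
  have gentle: "J x t = 0 \<and> v x t \<in> N" if t: "\<sigma> \<le> t" and small: "g x - g (v x t) < \<epsilon>" for x t
  proof
    have no_drop: "g (v x a) - g (v x b) < \<epsilon>" if "0 \<le> a" "b \<le> t" for a b
      using small g_mono[OF that(1), of x] g_mono[OF that(2), of x] by simp
    obtain n h where nh: "t = real n * h" "\<sigma> / 2 \<le> h" "h \<le> \<sigma>" using steps[OF t] by blast
    have "\<alpha>' (v x (real j * h)) (v x (real (Suc j) * h)) = 0" if "j < n" for j
    proof (rule N0)
      show "dist (v x (real j * h)) (v x (real (Suc j) * h)) < \<delta> / 2"
        using close[of "real j * h" "real (Suc j) * h" x] nh \<sigma>(1) by (simp add: algebra_simps)
      show "v x (real j * h) \<in> N"
      proof (rule ccontr)
        assume "v x (real j * h) \<notin> N"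
        then have "g (v x (real j * h)) - g (v x (real j * h + \<sigma> / 2)) \<ge> \<epsilon>"
          using drop(1) by (fastforce simp: flow_add)
        moreover have "real (Suc j) * h \<le> t"
          using that nh \<sigma>(1) by (auto intro!: mult_right_mono simp del: of_nat_Suc)
        then have "real j * h + \<sigma> / 2 \<le> t" using nh(2) by (simp add: algebra_simps)
        moreover have "0 \<le> real j * h" using nh \<sigma>(1) by simp
        ultimately show False using no_drop by force
      qed
    qed
    then show "J x t = 0" using J_telescope[of h x n] nh \<sigma>(1) by simp
    show "v x t \<in> N"
    proof (rule ccontr)
      assume "v x t \<notin> N"
      then have "g (v x (t - \<sigma> / 2)) - g (v x t) \<ge> \<epsilon>" using drop(2) by (fastforce simp: flow_add)
      then show False using no_drop[of "t - \<sigma> / 2" t] t \<sigma>(1) by simp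
    qed
  qed
  \<comment> \<open>One constant that dominates all the bounds.\<close>
  define C where "C = c + B + B / \<epsilon> * (M - m)"
  have c0: "0 \<le> c" using c[of undefined] by linarith
  have "m \<le> M" using mM(1)[of undefined] mM(2)[of undefined] by linarith
  then have K0: "0 \<le> B / \<epsilon> * (M - m)" using B0 \<epsilon> by simp
  have "\<bar>\<phi> x\<bar> \<le> C" "\<bar>\<alpha> x y - (\<phi> y - \<phi> x)\<bar> \<le> C" for x y
    using c[of x] \<alpha>'_B[of x y] c0 B0 K0 unfolding \<alpha>'_def C_def by linarith+
  moreover have "\<bar>J x t\<bar> \<le> C" if "0 \<le> t" for x t
    using J_long[of t x] J_short[of t x] that c0 B0 K0 unfolding C_def by linarith
  moreover have "J x t = 0 \<and> (\<forall>y. dist (v x t) y < \<delta> / 2 \<longrightarrow> \<alpha>' (v x t) y = 0)"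
    if "\<sigma> \<le> t" "g x - g (v x t) < \<epsilon>" for x t
    using gentle[OF that] N0 by blast
  ultimately show ?thesis using \<epsilon> \<sigma>(1) \<phi>(2)
    unfolding J_def \<alpha>'_def
    by (intro exI[of _ \<phi>] exI[of _ C] exI[of _ \<epsilon>] exI[of _ \<sigma>] exI[of _ "\<delta> / 2"]) auto
qed

end

section \<open>Chains cross regular levels a bounded number of times\<close>

text \<open>The critical values will be avoided by choosing one level in each cell of a grid of width
  \<open>\<epsilon>/2\<close>; an interval of length \<open>\<epsilon>\<close> contains a whole cell.\<close>

lemma finite_level_set_meets_long_intervals:
  fixes F :: "real set"
  assumes "finite F" "\<epsilon> > 0"
  shows "\<exists>P. finite P \<and> P \<inter> F = {} \<and>
    (\<forall>u w. m \<le> u \<longrightarrow> w \<le> M \<longrightarrow> \<epsilon> \<le> w - u \<longrightarrow> (\<exists>a\<in>P. u \<le> a \<and> a \<le> w))"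
proof -
  have "\<exists>a. a \<in> {m + real k * (\<epsilon> / 2)<..<m + real (Suc k) * (\<epsilon> / 2)} - F" for k
  proof -
    have "infinite {m + real k * (\<epsilon> / 2)<..<m + real (Suc k) * (\<epsilon> / 2)}"
      using assms(2) by (intro infinite_Ioo) (simp add: algebra_simps)
    then have "infinite ({m + real k * (\<epsilon> / 2)<..<m + real (Suc k) * (\<epsilon> / 2)} - F)"
      using assms(1) by (rule Diff_infinite_finite[rotated])
    then show ?thesis by (metis ex_in_conv finite.emptyI)
  qed
  then obtain a where a: "\<And>k. a k \<in> {m + real k * (\<epsilon> / 2)<..<m + real (Suc k) * (\<epsilon> / 2)} - F" by metis
  define K where "K = nat \<lceil>(M - m) / (\<epsilon> / 2)\<rceil>"
  have "\<exists>b\<in>a ` {..K}. u \<le> b \<and> b \<le> w" if uw: "m \<le> u" "w \<le> M" "\<epsilon> \<le> w - u" for u w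
  proof -
    define k where "k = nat \<lceil>(u - m) / (\<epsilon> / 2)\<rceil>"
    have "(u - m) / (\<epsilon> / 2) \<ge> 0" using uw assms(2) by simp
    then have k: "(u - m) / (\<epsilon> / 2) \<le> real k" "real k < (u - m) / (\<epsilon> / 2) + 1"
      unfolding k_def by linarith+
    have lo: "u \<le> m + real k * (\<epsilon> / 2)" using k(1) assms(2) by (simp add: field_simps)
    have "real k * (\<epsilon> / 2) < u - m + \<epsilon> / 2" using k(2) assms(2) by (simp add: field_simps)
    then have hi: "m + real (Suc k) * (\<epsilon> / 2) \<le> w" using uw assms(2) by (simp add: algebra_simps add_divide_distrib)
    have "k \<le> K" unfolding k_def K_def
      using uw assms(2) by (intro nat_mono ceiling_mono divide_right_mono) auto
    then show ?thesis using a[of k] lo hi by (intro bexI[of _ "a k"]) auto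
  qed
  moreover have "a ` {..K} \<inter> F = {}" using a by blast
  ultimately show ?thesis by (intro exI[of _ "a ` {..K}"]) auto
qed

text \<open>Here \<open>u i\<close> and \<open>w i\<close> are the values of \<open>g\<close> at the beginning and at the end of the \<open>i\<close>-th
  orbit segment of a chain.  After the first crossing of the level \<open>a\<close>, a jump may lift the chain
  just above \<open>a\<close> once, and so cause a second crossing.  That segment already ends below
  \<open>a - \<omega>\<close>, and from then on the jumps, which rise by less than \<open>\<omega>\<close>, cannot reach \<open>a\<close>.\<close>

lemma card_level_crossings:
  fixes u w :: "nat \<Rightarrow> real"
  assumes "\<omega> \<ge> 0"
    and fall: "\<And>i. i \<in> {1..k} \<Longrightarrow> u i \<le> a + \<omega> \<Longrightarrow> w i \<le> a - \<omega>"
    and jump: "\<And>i. i \<in> {1..k} \<Longrightarrow> u (Suc i) < w i + \<omega>"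
  shows "card {i\<in>{1..k}. w i \<le> a \<and> a \<le> u i} \<le> 2"
proof (cases "{i\<in>{1..k}. w i \<le> a \<and> a \<le> u i} = {}")
  case True
  then show ?thesis by (metis card.empty zero_le)
next
  case False
  define S where "S = {i\<in>{1..k}. w i \<le> a \<and> a \<le> u i}"
  define i0 where "i0 = Min S"
  have i0: "i0 \<in> S" "\<And>i. i \<in> S \<Longrightarrow> i0 \<le> i"
    using False Min_in[of S] Min_le[of S] unfolding i0_def S_def by auto
  have later: "w j \<le> a - \<omega>" if "Suc i0 \<le> j" "j \<le> k" for j
    using that
  proof (induction j rule: dec_induct)
    case base
    then show ?case using fall[of "Suc i0"] jump[of i0] i0(1) by (auto simp: S_def)
  next
    case (step j)
    have j: "j \<in> {1..k}" using step.hyps step.prems by auto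
    have "w j \<le> a - \<omega>" using step by simp
    then have "u (Suc j) < a" using jump[OF j] by linarith
    then show ?case using fall[of "Suc j"] step.prems \<open>\<omega> \<ge> 0\<close> by auto
  qed
  have "S \<subseteq> {i0, Suc i0}"
  proof
    fix i assume i: "i \<in> S"
    show "i \<in> {i0, Suc i0}"
    proof (rule ccontr)
      assume "i \<notin> {i0, Suc i0}"
      then obtain j where j: "i = Suc j" "Suc i0 \<le> j" using i0(2)[OF i] by (cases i) auto
      then have "u i < a" using later[of j] jump[of j] i by (auto simp: S_def)
      then show False using i by (simp add: S_def)
    qed
  qed
  then have "card S \<le> card {i0, Suc i0}" by (intro card_mono) auto
  then show ?thesis unfolding S_def by simp
qed

context lyapunov_flow
begin

text \<open>Only the segments along which \<open>g\<close> drops by at least \<open>\<epsilon>\<close> contribute to the integral of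
  \<open>\<alpha> - \<delta>\<phi>\<close>.  Each of them crosses one of the levels in the finite set \<open>P\<close>, so there are at
  most \<open>2 card P\<close> of them, and each contributes a bounded amount.\<close>

lemma fine_chain_integral_bounded:
  assumes "continuous_cocycle \<alpha>"
  shows "\<exists>B T \<eta>. T > 0 \<and> \<eta> > 0 \<and>
    (\<forall>k x t. (\<forall>i\<in>{1..k}. T \<le> t i \<and> dist (v (x i) (t i)) (x (Suc i)) < \<eta>) \<longrightarrow>
       \<bar>chain_integral v \<alpha> k x t\<bar> \<le> B)"
proof -
  obtain \<phi> B \<epsilon> \<sigma> \<delta> where pos: "\<epsilon> > 0" "\<sigma> > 0" "\<delta> > 0"
    and \<phi>B: "\<And>x. \<bar>\<phi> x\<bar> \<le> B"
    and \<alpha>B: "\<And>x y. \<bar>\<alpha> x y - (\<phi> y - \<phi> x)\<bar> \<le> B"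
    and JB: "\<And>x t. 0 \<le> t \<Longrightarrow> \<bar>cocycle_integral \<alpha> (v x) 0 t - (\<phi> (v x t) - \<phi> x)\<bar> \<le> B"
    and gentle: "\<And>x t. \<sigma> \<le> t \<Longrightarrow> g x - g (v x t) < \<epsilon> \<Longrightarrow>
       cocycle_integral \<alpha> (v x) 0 t = \<phi> (v x t) - \<phi> x \<and>
       (\<forall>y. dist (v x t) y < \<delta> \<longrightarrow> \<alpha> (v x t) y = \<phi> y - \<phi> (v x t))"
    using orbit_integral_estimate[OF assms] by blast
  have B0: "B \<ge> 0" using \<phi>B[of undefined] by linarith
  obtain m M where mM: "\<And>x. m \<le> g x" "\<And>x. g x \<le> M" using g_bounded by blast
  obtain P where P: "finite P" "P \<inter> g ` fixed_points v = {}"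
    "\<And>u w. \<lbrakk>m \<le> u; w \<le> M; \<epsilon> \<le> w - u\<rbrakk> \<Longrightarrow> \<exists>a\<in>P. u \<le> a \<and> a \<le> w"
    using finite_level_set_meets_long_intervals[OF finite_imageI[OF finite_fixed] pos(1), of g m M]
    by blast
  obtain \<omega> where \<omega>: "\<omega> > 0"
    "\<And>a x t. a \<in> P \<Longrightarrow> t \<ge> \<sigma> \<Longrightarrow> g x \<le> a + \<omega> \<Longrightarrow> g (v x t) \<le> a - \<omega>"
    using uniform_regular_level_gap[OF P(1,2) pos(2)] by blast
  have "uniformly_continuous_on UNIV g"
    using compact_uniformly_continuous[OF continuous_g compact_space] .
  then obtain \<eta> where \<eta>: "\<eta> > 0" "\<And>x y. dist y x < \<eta> \<Longrightarrow> dist (g y) (g x) < \<omega>"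
    unfolding uniformly_continuous_on_def using \<omega>(1) by (metis UNIV_I)
  have "\<bar>chain_integral v \<alpha> k x t\<bar> \<le> real (2 * card P) * (2 * B) + 2 * B"
    if chain: "\<And>i. i \<in> {1..k} \<Longrightarrow> \<sigma> \<le> t i"
      "\<And>i. i \<in> {1..k} \<Longrightarrow> dist (v (x i) (t i)) (x (Suc i)) < min \<eta> \<delta>" for k x t
  proof -
    define y where "y i = v (x i) (t i)" for i
    \<comment> \<open>The contribution of the \<open>i\<close>-th segment and the jump after it, corrected by \<open>\<delta>\<phi>\<close>.\<close>
    define E where "E i = (cocycle_integral \<alpha> (v (x i)) 0 (t i) - (\<phi> (y i) - \<phi> (x i)))
        + (\<alpha> (y i) (x (Suc i)) - (\<phi> (x (Suc i)) - \<phi> (y i)))" for i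
    define big where "big = {i\<in>{1..k}. \<epsilon> \<le> g (x i) - g (y i)}"
    have E_bound: "\<bar>E i\<bar> \<le> 2 * B" if "i \<in> {1..k}" for i
    proof -
      have "0 \<le> t i" using chain(1)[OF that] pos(2) by linarith
      then show ?thesis
        using JB[of "t i" "x i"] \<alpha>B[of "y i" "x (Suc i)"] unfolding E_def y_def by linarith
    qed
    have E_zero: "E i = 0" if "i \<in> {1..k}" "i \<notin> big" for i
      using gentle[of "t i" "x i"] chain[of i] that unfolding E_def big_def y_def by auto
    have "big \<subseteq> (\<Union>a\<in>P. {i\<in>{1..k}. g (y i) \<le> a \<and> a \<le> g (x i)})"
      using P(3)[OF mM(1) mM(2)] unfolding big_def by fastforce
    then have "card big \<le> card (\<Union>a\<in>P. {i\<in>{1..k}. g (y i) \<le> a \<and> a \<le> g (x i)})"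
      using P(1) by (intro card_mono) auto
    also have "\<dots> \<le> (\<Sum>a\<in>P. card {i\<in>{1..k}. g (y i) \<le> a \<and> a \<le> g (x i)})"
      using P(1) by (rule card_UN_le)
    also have "\<dots> \<le> (\<Sum>a\<in>P. 2)"
    proof (intro sum_mono card_level_crossings)
      show "\<omega> \<ge> 0" using \<omega>(1) by simp
    next
      fix a i assume a: "a \<in> P" and i: "i \<in> {1..k}"
      show "g (y i) \<le> a - \<omega>" if "g (x i) \<le> a + \<omega>"
        using \<omega>(2)[OF a chain(1)[OF i] that] by (simp add: y_def)
      show "g (x (Suc i)) < g (y i) + \<omega>"
        using \<eta>(2)[of "y i" "x (Suc i)"] chain(2)[OF i] by (simp add: y_def dist_real_def)
    qed
    finally have card_big: "card big \<le> 2 * card P" by simp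
    have "(\<Sum>i=1..k. E i) = (\<Sum>i\<in>big. E i)"
      by (rule sum.mono_neutral_right) (auto simp: big_def E_zero)
    moreover have "\<bar>\<Sum>i\<in>big. E i\<bar> \<le> (\<Sum>i\<in>big. 2 * B)"
      using E_bound by (intro order_trans[OF sum_abs] sum_mono) (auto simp: big_def)
    moreover have "(\<Sum>i\<in>big. 2 * B) \<le> real (2 * card P) * (2 * B)"
      using card_big B0 by (simp add: mult_right_mono flip: of_nat_mult)
    ultimately have sumE: "\<bar>\<Sum>i=1..k. E i\<bar> \<le> real (2 * card P) * (2 * B)" by linarith
    have "chain_integral v \<alpha> k x t = (\<Sum>i=1..k. E i + (\<phi> (x (Suc i)) - \<phi> (x i)))"
      unfolding chain_integral_def E_def y_def by (intro sum.cong) auto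
    also have "\<dots> = (\<Sum>i=1..k. E i) + (\<Sum>i=1..k. \<phi> (x (Suc i)) - \<phi> (x i))"
      by (rule sum.distrib)
    also have "(\<Sum>i=1..k. \<phi> (x (Suc i)) - \<phi> (x i)) = \<phi> (x (Suc k)) - \<phi> (x 1)"
      using sum_Suc_diff[of 1 k "\<lambda>i. \<phi> (x i)"] by simp
    finally show ?thesis using sumE \<phi>B[of "x (Suc k)"] \<phi>B[of "x 1"] by linarith
  qed
  then show ?thesis using pos \<eta>(1)
    by (intro exI[of _ "real (2 * card P) * (2 * B) + 2 * B"] exI[of _ \<sigma>] exI[of _ "min \<eta> \<delta>"]) auto
qed

lemma orbit_integral_bounded:
  assumes "continuous_cocycle \<alpha>"
  shows "\<exists>B. \<forall>x t. 0 \<le> t \<longrightarrow> \<bar>cocycle_integral \<alpha> (v x) 0 t\<bar> \<le> B"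
proof -
  obtain \<phi> B where \<phi>B: "\<And>x. \<bar>\<phi> x\<bar> \<le> B"
    and JB: "\<And>x t. 0 \<le> t \<Longrightarrow> \<bar>cocycle_integral \<alpha> (v x) 0 t - (\<phi> (v x t) - \<phi> x)\<bar> \<le> B"
    using orbit_integral_estimate[OF assms] by blast
  have "\<bar>cocycle_integral \<alpha> (v x) 0 t\<bar> \<le> 3 * B" if "0 \<le> t" for x t
    using JB[OF that, of x] \<phi>B[of x] \<phi>B[of "v x t"] by linarith
  then show ?thesis by blast
qed

end

section \<open>Nonexistence of a Lyapunov function\<close>

lemma alpha_flow_finite_fixed_points:
  assumes "alpha_flow v \<alpha>"
  shows "finite (fixed_points v)"
proof -
  obtain A where gen: "generalized_alpha_flow v \<alpha> A" and pts: "\<forall>C\<in>components A. \<exists>p. C = {p}"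
    using assms unfolding alpha_flow_def by blast
  have A: "fixed_points v \<subseteq> A" "finite (components A)"
    using gen[unfolded generalized_alpha_flow_def, THEN conjunct2, THEN conjunct1]
      gen[unfolded generalized_alpha_flow_def, THEN conjunct2, THEN conjunct2, THEN conjunct1]
    by this+
  have "finite C" if "C \<in> components A" for C using pts that by auto
  then have "finite (\<Union>(components A))" by (intro finite_Union A(2))
  moreover have "\<Union>(components A) = A" by (rule Union_components)
  ultimately show ?thesis using A(1) finite_subset by simp
qed

theorem theorem3p3:
  fixes v :: "'a::metric_space \<Rightarrow> real \<Rightarrow> 'a"
    and \<alpha> :: "'a \<Rightarrow> 'a \<Rightarrow> real"
    and s :: "nat \<Rightarrow> real"
    and \<U> :: "real \<Rightarrow> 'a set set"
  assumes "compact (UNIV :: 'a set)"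
    and "is_flow v"
    and "finite (components (fixed_points v))"
    and "continuous_cocycle \<alpha>" and "nontrivial \<alpha>"
    and "alpha_flow v \<alpha>"
    and "\<And>i. s i > 0" and "s \<longlonglongrightarrow> 0"
    and "\<And>\<sigma>. \<sigma> > 0 \<Longrightarrow> ball_cover \<sigma> (\<U> \<sigma>)"
  shows "((\<forall>M>0. \<forall>T>0. \<forall>i. \<exists>k x t. is_chain v (\<U> (s i)) T k x t \<and>
              \<bar>chain_integral v \<alpha> k x t\<bar> \<ge> M)
            \<longrightarrow> \<not> gradient_like v) \<and>
         ((\<forall>M>0. \<exists>x t. t \<ge> 0 \<and> \<bar>cocycle_integral \<alpha> (v x) 0 t\<bar> \<ge> M)
            \<longrightarrow> \<not> gradient_like v) \<and>
         ((\<exists>\<gamma>. oriented_orbit_cycle v \<gamma> \<and> \<bar>cocycle_integral \<alpha> \<gamma> 0 1\<bar> \<ge> 1)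
            \<longrightarrow> \<not> gradient_like v)"
proof (intro conjI impI)
  have lyapunov: "\<exists>g. lyapunov_flow v g" if "gradient_like v"
    using that assms(1,2) alpha_flow_finite_fixed_points[OF assms(6)]
    unfolding gradient_like_def lyapunov_flow_def by blast
  show "\<not> gradient_like v"
    if long: "\<forall>M>0. \<forall>T>0. \<forall>i. \<exists>k x t. is_chain v (\<U> (s i)) T k x t \<and> \<bar>chain_integral v \<alpha> k x t\<bar> \<ge> M"
  proof
    assume "gradient_like v"
    then obtain g where "lyapunov_flow v g" using lyapunov by blast
    then obtain B T \<eta> where T: "T > 0" and \<eta>: "\<eta> > 0"
      and B: "\<And>k x t. (\<And>i. i \<in> {1..k} \<Longrightarrow> T \<le> t i \<and> dist (v (x i) (t i)) (x (Suc i)) < \<eta>) \<Longrightarrow>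
         \<bar>chain_integral v \<alpha> k x t\<bar> \<le> B"
      using lyapunov_flow.fine_chain_integral_bounded[OF _ assms(4)] by meson
    obtain i where i: "s i < \<eta> / 2"
      using order_tendstoD(2)[OF assms(8), of "\<eta> / 2"] \<eta> by (auto simp: eventually_sequentially)
    obtain k x t where chain: "is_chain v (\<U> (s i)) T k x t"
      and large: "\<bar>chain_integral v \<alpha> k x t\<bar> \<ge> max 1 (B + 1)"
      using long T by (metis less_max_iff_disj zero_less_one)
    have "dist (v (x j) (t j)) (x (Suc j)) < \<eta>" if j: "j \<in> {1..k}" for j
    proof -
      obtain C where C: "C \<in> \<U> (s i)" "v (x j) (t j) \<in> C" "x (Suc j) \<in> C"
        using chain j unfolding is_chain_def by metis
      then obtain z where "C = ball z (s i)"
        using assms(9)[OF assms(7)[of i]] unfolding ball_cover_def by metis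
      then have "dist z (v (x j) (t j)) < s i" "dist z (x (Suc j)) < s i" using C by auto
      then show ?thesis
        using dist_triangle3[of "v (x j) (t j)" "x (Suc j)" z] i by simp
    qed
    then have "\<bar>chain_integral v \<alpha> k x t\<bar> \<le> B"
      using chain by (intro B) (auto simp: is_chain_def)
    then show False using large by linarith
  qed
  show "\<not> gradient_like v"
    if long: "\<forall>M>0. \<exists>x t. t \<ge> 0 \<and> \<bar>cocycle_integral \<alpha> (v x) 0 t\<bar> \<ge> M"
  proof
    assume "gradient_like v"
    then obtain g where "lyapunov_flow v g" using lyapunov by blast
    then obtain B where B: "\<And>x t. 0 \<le> t \<Longrightarrow> \<bar>cocycle_integral \<alpha> (v x) 0 t\<bar> \<le> B"
      using lyapunov_flow.orbit_integral_bounded[OF _ assms(4)] by meson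
    obtain x t where "t \<ge> 0" "\<bar>cocycle_integral \<alpha> (v x) 0 t\<bar> \<ge> max 1 (B + 1)"
      using long by (metis less_max_iff_disj zero_less_one)
    then show False using B[of t x] by linarith
  qed
  show "\<not> gradient_like v"
    if "\<exists>\<gamma>. oriented_orbit_cycle v \<gamma> \<and> \<bar>cocycle_integral \<alpha> \<gamma> 0 1\<bar> \<ge> 1"
    using that lyapunov lyapunov_flow.no_oriented_orbit_cycle by blast
qed

end
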